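(* Let $G$ be a tree with $n \geq 3$ vertices. Suppose $A=(a_{ij}) \in \mathbb{P}_G([0,\infty))$. Then $A^{\circ \alpha} := (a_{ij}^\alpha)_{i,j} \in \mathbb{P}_G$ for every real $\alpha \geq 1$. If $0 < \alpha < 1$ and $0 < R \leq \infty$, then there exists $A_R \in \mathbb{P}_G([0,R))$ such that $A_R^{\circ \alpha} \notin \mathbb{P}_G$.
   Context: All graphs $G=(V,E)$ are finite, undirected, with no self-loops, with vertex set $V=\{1,\dots,n\}$ and $|G|:=|V|$. For $I \subset \mathbb{R}$, $\mathbb{P}_G(I)$ is the set of real symmetric positive semidefinite $|G|\times|G|$ matrices $A=(a_{ij})$ with all entries in $I$ and with $a_{ij}=0$ for every $(i,j)\notin E$, $i\neq j$; write $\mathbb{P}_G := \mathbb{P}_G(\mathbb{R})$. The power $A^{\circ\alpha}$ is entrywise. *)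

theory Defs
  imports "HOL-Analysis.Analysis" "Graph_Theory.Graph_Theory"
begin

text \<open>
  An undirected simple graph is a symmetric, loop-free \<^typ>\<open>'a pair_pre_digraph\<close>
  (locale \<^locale>\<open>pair_graph\<close>), each edge being represented by both of its orientations.
  The predicate \<open>tree\<close> of the graph library is unusable here: for symmetric digraphs it
  regards the walk u, v, u as a cycle, so no graph with an edge would be a tree.  Cycles of
  an undirected graph are the library's cycles of length at least three.
\<close>

definition undirected_tree :: "'a pair_pre_digraph \<Rightarrow> bool" where
  "undirected_tree G \<longleftrightarrow>
     pair_graph G \<and> Digraph_Component.connected (with_proj G) \<and>
     \<not> (\<exists>p. pre_digraph.cycle (with_proj G) p \<and> 3 \<le> length p)"

definition positive_semidefinite :: "real^'n^'n \<Rightarrow> bool" where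
  "positive_semidefinite A \<longleftrightarrow> (\<forall>x. 0 \<le> x \<bullet> (A *v x))"

text \<open>
  The vertices are the elements of a finite type \<open>'n\<close>, which also indexes the matrices.
\<close>

definition psd_matrices_on :: "'n::finite pair_pre_digraph \<Rightarrow> real set \<Rightarrow> (real^'n^'n) set"
    (\<open>\<P>\<^bsub>_\<^esub>\<close>) where
  "\<P>\<^bsub>G\<^esub> I = {A. transpose A = A \<and> positive_semidefinite A \<and>
               (\<forall>i j. A $ i $ j \<in> I) \<and>
               (\<forall>i j. i \<noteq> j \<and> (i, j) \<notin> parcs G \<longrightarrow> A $ i $ j = 0)}"

text \<open>
  Only used for positive exponents, where \<open>0 powr \<alpha> = 0\<close> is the intended value, and for
  matrices with nonnegative entries.
\<close>

definition hadamard_power :: "real^'n^'n \<Rightarrow> real \<Rightarrow> real^'n^'n" (infixr \<open>\<circ>powr\<close> 80) where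
  "A \<circ>powr \<alpha> = map_matrix (\<lambda>a. a powr \<alpha>) A"

end

theory Submission
  imports Defs
begin

text \<open>
  For \<open>\<alpha> \<ge> 1\<close> the reason is that one can eliminate the vertices of a tree leaf by leaf, and
  that eliminating a leaf \<open>v\<close> with neighbour \<open>u\<close> is Gaussian elimination without fill-in: it
  only changes the diagonal entry \<open>a\<^sub>u\<^sub>u\<close>, to \<open>d = a\<^sub>u\<^sub>u - c\<close> with \<open>c = a\<^sub>u\<^sub>v\<^sup>2 / a\<^sub>v\<^sub>v\<close>.  The matrix is
  positive semidefinite iff \<open>a\<^sub>v\<^sub>v > 0\<close> and the remaining Schur complement is positive
  semidefinite (the case \<open>a\<^sub>u\<^sub>v = 0\<close>, where \<open>v\<close> splits off, aside).  By induction the entrywise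
  power of the Schur complement is positive semidefinite; its entry at \<open>u\<close> is \<open>d\<^sup>\<alpha>\<close>.  The Schur
  complement of the power has the entry \<open>a\<^sub>u\<^sub>u\<^sup>\<alpha> - c\<^sup>\<alpha>\<close> instead and agrees with it elsewhere.  As
  \<open>a\<^sub>u\<^sub>u = c + d\<close>, superadditivity of \<open>x \<mapsto> x\<^sup>\<alpha>\<close> on the nonnegative reals says exactly that
  \<open>a\<^sub>u\<^sub>u\<^sup>\<alpha> - c\<^sup>\<alpha> \<ge> d\<^sup>\<alpha>\<close>.  The lemma \<open>forest_powr_nonneg\<close> carries this out; it needs of the tree only
  that every nonempty set of vertices contains one with at most one neighbour in that set
  (\<open>undirected_tree_leaf\<close>).

  For \<open>\<alpha> < 1\<close> superadditivity fails, and a path \<open>u, v, w\<close> shows it: with the indicator vectors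
  \<open>s\<close> of \<open>{v, u}\<close> and \<open>t\<close> of \<open>{v, w}\<close>, the matrix \<open>s s\<^sup>T + t t\<^sup>T\<close> annihilates the vector that is
  \<open>1\<close> at \<open>v\<close> and \<open>-1\<close> at \<open>u\<close> and \<open>w\<close>.  Its entries are \<open>0\<close> and \<open>1\<close>, except for a \<open>2\<close> at \<open>(v, v)\<close>; so
  the power only decreases that entry, which makes the quadratic form negative at this vector.
  Small multiples of the matrix serve every bound \<open>R\<close> (\<open>two_edge_matrix\<close>).
\<close>

section \<open>Leaves of a tree\<close>

lemma awalk_vwalk_arcs:
  assumes "vwalk p (with_proj G)"
  shows "pre_digraph.awalk (with_proj G) (hd p) (vwalk_arcs p) (last p)"
    and "pre_digraph.awalk_verts (with_proj G) (hd p) (vwalk_arcs p) = p"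
proof -
  have "p \<noteq> []" and verts: "set p \<subseteq> pverts G" and arcs: "set (vwalk_arcs p) \<subseteq> parcs G"
    using assms by (auto simp: vwalk_def)
  have "pcas (hd p) (vwalk_arcs p) (last p)" if "p \<noteq> []" for p :: "'a list"
    using that by (induction p rule: vwalk_arcs.induct) auto
  then show "pre_digraph.awalk (with_proj G) (hd p) (vwalk_arcs p) (last p)"
    using \<open>p \<noteq> []\<close> verts arcs by (auto simp: pre_digraph.awalk_def cas_with_proj_eq)
  have "pawalk_verts (hd p) (vwalk_arcs p) = p" if "p \<noteq> []" for p :: "'a list"
    using that by (induction p rule: vwalk_arcs.induct) auto
  then show "pre_digraph.awalk_verts (with_proj G) (hd p) (vwalk_arcs p) = p"
    using \<open>p \<noteq> []\<close> by (simp add: awalk_verts_with_proj_eq)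
qed

text \<open>
  Among the paths inside \<open>S\<close> take a longest one.  A neighbour of its first vertex in \<open>S\<close> lies on
  the path, and if it were not the second vertex, the path up to it would close to a cycle.
  For a set with a single vertex, or without any edge at \<open>v\<close>, the vertex \<open>u\<close> is arbitrary.
\<close>

lemma undirected_tree_leaf:
  assumes tree: "undirected_tree G" and S: "S \<subseteq> pverts G" "S \<noteq> {}"
  obtains v u where "v \<in> S" "\<And>w. w \<in> S \<Longrightarrow> (v, w) \<in> parcs G \<Longrightarrow> w = u"
proof -
  interpret pair_graph G
    using tree by (simp add: undirected_tree_def)
  have finS: "finite S"
    using S(1) pair_finite_verts finite_subset by blast
  define path where "path p \<longleftrightarrow> vpath p (with_proj G) \<and> set p \<subseteq> S" for p
  obtain s where "s \<in> S" using S(2) by blast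
  then have "path [s]" using S(1) by (auto simp: path_def vpath_def vwalk_def)
  moreover have "length p < Suc (card S)" if "path p" for p
    using that card_mono[OF finS, of "set p"]
    by (auto simp: path_def vpath_def distinct_card)
  ultimately obtain p where p: "path p" and longest: "\<And>q. path q \<Longrightarrow> length q \<le> length p"
    using ex_has_greatest_nat[of path _ length "Suc (card S)"] by blast
  from p have "p \<noteq> []" by (auto simp: path_def vpath_def vwalk_def)
  then obtain v q where pq: "p = v # q" by (cases p) auto
  \<comment> \<open>If \<open>q\<close> is empty, the argument shows that there is no such \<open>w\<close> at all.\<close>
  have "w = hd q" if w: "w \<in> S" "(v, w) \<in> parcs G" for w
  proof (rule ccontr)
    assume "w \<noteq> hd q"
    have wv: "(w, v) \<in> parcs G" using w(2) arcs_symmetric by blast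
    have "w \<noteq> v" using w(2) no_loops' by blast
    have "w \<in> set p"
    proof (rule ccontr)
      assume "w \<notin> set p"
      then have "path (w # p)"
        using p w wv S(1) unfolding pq by (auto simp: path_def vpath_def vwalk_def)
      from longest[OF this] show False by simp
    qed
    with \<open>w \<noteq> v\<close> pq have "w \<in> set q" by simp
    then obtain as bs where q: "q = as @ w # bs" by (meson split_list)
    with \<open>w \<noteq> hd q\<close> have "as \<noteq> []" by auto
    define c where "c = v # as @ [w]"
    have "vwalk (c @ bs) (with_proj G)" and dist: "distinct c"
      using p by (auto simp: path_def vpath_def pq q c_def)
    then have "vwalk c (with_proj G)"
      using vwalkI_append_l[of c bs] by (simp add: c_def)
    then have closed: "vwalk (w # c) (with_proj G)"
      using wv w(1) S(1) by (auto simp: vwalk_def c_def)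
    have "pre_digraph.cycle (with_proj G) (vwalk_arcs (w # c))"
      using awalk_vwalk_arcs[OF closed] dist unfolding pre_digraph.cycle_def
      by (intro exI[of _ w]) (auto simp: c_def)
    moreover have "3 \<le> length (vwalk_arcs (w # c))"
      using \<open>as \<noteq> []\<close> vwalk_length_simp[of "w # c"]
      by (cases as) (auto simp: vwalk_length_def c_def)
    ultimately show False using tree by (auto simp: undirected_tree_def)
  qed
  then show thesis using that[of v "hd q"] p by (simp add: path_def pq)
qed

text \<open>
  Otherwise a vertex together with its only possible neighbour is closed under adjacency, and by
  connectedness these at most two vertices are all.
\<close>

lemma connected_vertex_with_two_neighbours:
  fixes G :: "'n::finite pair_pre_digraph"
  assumes G: "pair_graph G" and conn: "Digraph_Component.connected (with_proj G)"
    and "pverts G = UNIV" and card: "CARD('n) \<ge> 3"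
  obtains v u w where "(v, u) \<in> parcs G" "(v, w) \<in> parcs G" "u \<noteq> w"
proof (rule ccontr)
  assume "\<not> thesis"
  with that have unique: "u = w" if "(v, u) \<in> parcs G" "(v, w) \<in> parcs G" for v u w
    using \<open>(v, u) \<in> parcs G\<close> \<open>(v, w) \<in> parcs G\<close> by blast
  interpret pair_graph G by fact
  fix a :: 'n
  define N where "N = insert a {b. (a, b) \<in> parcs G}"
  have "(parcs G)\<^sup>s = parcs G"
    using arcs_symmetric by (auto simp: symcl_def)
  then have "a \<rightarrow>\<^sup>*\<^bsub>with_proj G\<^esub> b" for b
    using conn assms(3) by (simp add: connected_conv reachable_def)
  moreover have "b \<in> N" if "a \<rightarrow>\<^sup>*\<^bsub>with_proj G\<^esub> b" for b
    using that
  proof (induction rule: reachable_induct)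
    case base
    then show ?case by (simp add: N_def)
  next
    case (step x y)
    then show ?case using unique arcs_symmetric by (auto simp: N_def)
  qed
  ultimately have "UNIV \<subseteq> N" by blast
  moreover obtain b where "N \<subseteq> {a, b}"
    using unique by (cases "\<exists>b. (a, b) \<in> parcs G") (auto simp: N_def)
  ultimately have "CARD('n) \<le> card {a, b}"
    by (intro card_mono) auto
  also have "\<dots> \<le> 2" by (simp add: card_insert_if)
  finally show False using card by simp
qed

section \<open>Eliminating a leaf from a quadratic form\<close>

text \<open>
  The index set is a parameter, so that an induction can remove indices; a matrix type fixes its
  dimension.
\<close>

definition quadratic_form :: "'a set \<Rightarrow> ('a \<Rightarrow> 'a \<Rightarrow> real) \<Rightarrow> ('a \<Rightarrow> real) \<Rightarrow> real" where
  "quadratic_form S a x = (\<Sum>i\<in>S. \<Sum>j\<in>S. a i j * x i * x j)"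

lemma positive_semidefinite_iff_quadratic_form:
  "positive_semidefinite A \<longleftrightarrow> (\<forall>x. 0 \<le> quadratic_form UNIV (\<lambda>i j. A $ i $ j) x)"
proof -
  have eq: "y \<bullet> (A *v y) = quadratic_form UNIV (\<lambda>i j. A $ i $ j) (($) y)" for y
    by (simp add: quadratic_form_def inner_vec_def matrix_vector_mult_def sum_distrib_left
        mult_ac)
  show ?thesis
    unfolding positive_semidefinite_def eq
  proof safe
    fix x assume "\<forall>y. 0 \<le> quadratic_form UNIV (\<lambda>i j. A $ i $ j) (($) y)"
    from this[rule_format, of "vec_lambda x"]
    show "0 \<le> quadratic_form UNIV (\<lambda>i j. A $ i $ j) x" by (simp add: vec_lambda_inverse)
  qed auto
qed

lemma quadratic_form_cong:
  assumes "\<And>i. i \<in> S \<Longrightarrow> x i = y i"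
  shows "quadratic_form S a x = quadratic_form S a y"
  using assms by (simp add: quadratic_form_def)

lemma quadratic_form_insert:
  assumes "finite S" "v \<notin> S"
  shows "quadratic_form (insert v S) a x =
    a v v * (x v)\<^sup>2 + (\<Sum>j\<in>S. (a v j + a j v) * x j) * x v + quadratic_form S a x"
  using assms
  by (simp add: quadratic_form_def sum.distrib sum_distrib_left sum_distrib_right algebra_simps
      power2_eq_square)

lemma quadratic_form_insert_leaf:
  assumes "finite S" "v \<notin> S" "u \<in> S" "a u v = a v u"
    and "\<And>w. w \<in> S \<Longrightarrow> w \<noteq> u \<Longrightarrow> a v w = 0 \<and> a w v = 0"
  shows "quadratic_form (insert v S) a x =
    a v v * (x v)\<^sup>2 + 2 * a v u * x u * x v + quadratic_form S a x"
proof -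
  have "(\<Sum>j\<in>S. (a v j + a j v) * x j) = (\<Sum>j\<in>S. if j = u then 2 * a v u * x u else 0)"
    using assms(4,5) by (intro sum.cong) auto
  then show ?thesis using assms(1-3) by (simp add: quadratic_form_insert)
qed

lemma quadratic_form_insert_isolated:
  assumes "finite S" "v \<notin> S" "\<And>w. w \<in> S \<Longrightarrow> a v w = 0 \<and> a w v = 0"
  shows "quadratic_form (insert v S) a x = a v v * (x v)\<^sup>2 + quadratic_form S a x"
  using assms by (simp add: quadratic_form_insert)

lemma quadratic_form_change_diagonal:
  assumes "finite S" "u \<in> S"
  shows "quadratic_form S (a(u := (a u)(u := d))) x =
    quadratic_form S a x + (d - a u u) * (x u)\<^sup>2"
proof -
  obtain T where T: "S = insert u T" "u \<notin> T" "finite T"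
    using assms by (metis finite_insert mk_disjoint_insert)
  have "quadratic_form T (a(u := (a u)(u := d))) x = quadratic_form T a x"
    using T(2) unfolding quadratic_form_def by (intro sum.cong) auto
  moreover have "(\<Sum>j\<in>T. ((a(u := (a u)(u := d))) u j + (a(u := (a u)(u := d))) j u) * x j) =
      (\<Sum>j\<in>T. (a u j + a j u) * x j)"
    using T(2) by (intro sum.cong) auto
  ultimately show ?thesis
    unfolding T(1) by (simp add: quadratic_form_insert[OF T(3,2)] algebra_simps)
qed

lemma quadratic_form_unit:
  assumes "finite S" "u \<in> S"
  shows "quadratic_form S a (\<lambda>i. if i = u then t else 0) = a u u * t\<^sup>2"
proof -
  have "quadratic_form S a (\<lambda>i. if i = u then t else 0) =
      (\<Sum>i\<in>S. if i = u then (\<Sum>j\<in>S. if j = u then a u u * t\<^sup>2 else 0) else 0)"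
    unfolding quadratic_form_def by (intro sum.cong) (auto simp: power2_eq_square intro!: sum.cong)
  then show ?thesis using assms by simp
qed

section \<open>Powers at least one\<close>

lemma powr_superadditive:
  fixes x y p :: real
  assumes "0 \<le> x" "0 \<le> y" "1 \<le> p"
  shows "x powr p + y powr p \<le> (x + y) powr p"
proof -
  have split: "z powr p = z * z powr (p - 1)" if "0 \<le> z" for z :: real
    using that assms(3) by (cases "z = 0") (auto simp: powr_diff)
  have "x * x powr (p - 1) \<le> x * (x + y) powr (p - 1)"
       "y * y powr (p - 1) \<le> y * (x + y) powr (p - 1)"
    using assms by (auto intro!: mult_left_mono powr_mono2)
  then show ?thesis
    using assms by (simp add: split distrib_right)
qed

lemma binary_form_nonneg:
  fixes p q r x y :: real
  assumes "0 < p" "q\<^sup>2 = p * r"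
  shows "0 \<le> p * x\<^sup>2 + 2 * q * y * x + r * y\<^sup>2"
proof -
  have "p * (p * x\<^sup>2 + 2 * q * y * x + r * y\<^sup>2) = (p * x + q * y)\<^sup>2 + (p * r - q\<^sup>2) * y\<^sup>2"
    by algebra
  then have "0 \<le> p * (p * x\<^sup>2 + 2 * q * y * x + r * y\<^sup>2)"
    by (simp add: assms(2))
  then show ?thesis using assms(1) by (simp add: zero_le_mult_iff)
qed

text \<open>
  The graph enters only through the assumption on leaves, which is inherited by subsets of \<open>S\<close> and
  does not see the diagonal.  Hence the induction hypothesis applies to the Schur complement.
\<close>

lemma forest_powr_nonneg:
  fixes a :: "'a \<Rightarrow> 'a \<Rightarrow> real"
  assumes "finite S"
    and sym: "\<And>i j. a i j = a j i"
    and nonneg: "\<And>i j. 0 \<le> a i j"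
    and leaf: "\<And>T. T \<subseteq> S \<Longrightarrow> T \<noteq> {} \<Longrightarrow>
      \<exists>v\<in>T. \<exists>u. \<forall>w\<in>T. w \<noteq> v \<longrightarrow> w \<noteq> u \<longrightarrow> a v w = 0"
    and psd: "\<And>x. 0 \<le> quadratic_form S a x"
    and "1 \<le> \<alpha>"
  shows "0 \<le> quadratic_form S (\<lambda>i j. a i j powr \<alpha>) x"
  using assms(1-5)
proof (induction "card S" arbitrary: S a x)
  case 0
  then show ?case by (simp add: quadratic_form_def)
next
  case (Suc n)
  note sym = Suc.prems(2) and nonneg = Suc.prems(3) and leaf = Suc.prems(4)
    and psd = Suc.prems(5)
  have "S \<noteq> {}" using Suc.hyps(2) by auto
  then obtain v u where v: "v \<in> S" and vu: "\<And>w. w \<in> S \<Longrightarrow> w \<noteq> v \<Longrightarrow> w \<noteq> u \<Longrightarrow> a v w = 0"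
    using leaf[of S] by blast
  define T where "T = S - {v}"
  have S: "S = insert v T" and vT: "v \<notin> T" and finT: "finite T" and cardT: "n = card T"
    using v Suc.prems(1) Suc.hyps(2) by (auto simp: T_def)
  let ?p = "\<lambda>i j. a i j powr \<alpha>"
  show ?case
  proof (cases "u \<in> T \<and> a v u \<noteq> 0")
    case False
    then have "a v w = 0" if "w \<in> T" for w
      using vu[of w] that vT by (cases "w = u") (auto simp: S)
    then have iso: "a v w = 0 \<and> a w v = 0" if "w \<in> T" for w
      using that sym[of v w] by simp
    have "0 \<le> quadratic_form T a y" for y
    proof -
      have "quadratic_form S a (y(v := 0)) = quadratic_form T a (y(v := 0))"
        using quadratic_form_insert_isolated[OF finT vT, of a] iso by (simp add: S)
      also have "\<dots> = quadratic_form T a y"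
        using vT by (intro quadratic_form_cong) auto
      finally show ?thesis using psd by metis
    qed
    then have "0 \<le> quadratic_form T ?p x"
      using S by (intro Suc.hyps(1) cardT finT sym nonneg leaf) auto
    then show ?thesis
      using quadratic_form_insert_isolated[OF finT vT, of ?p] iso by (simp add: S)
  next
    case True
    then have uT: "u \<in> T" and q: "0 < a v u" and uv: "u \<noteq> v"
      using nonneg[of v u] vT by auto
    have nbr: "a v w = 0 \<and> a w v = 0" if "w \<in> T" "w \<noteq> u" for w
      using vu[of w] that vT sym[of v w] by (auto simp: S)
    have form: "quadratic_form S a y =
        a v v * (y v)\<^sup>2 + 2 * a v u * y u * y v + quadratic_form T a y" for y
      unfolding S by (intro quadratic_form_insert_leaf finT vT uT sym nbr)
    \<comment> \<open>With \<open>a v v = 0\<close> the form would be affine and nonconstant in the coordinate at \<open>v\<close>; the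
      vector \<open>y\<close> below makes it \<open>-1\<close>.\<close>
    have pos: "0 < a v v"
    proof (rule ccontr)
      assume "\<not> 0 < a v v"
      then have "a v v = 0" using nonneg[of v v] by simp
      define y where "y = (\<lambda>i. if i = u then 1 else 0)(v := - (a u u + 1) / (2 * a v u))"
      have "quadratic_form T a y = quadratic_form T a (\<lambda>i. if i = u then 1 else 0)"
        using vT by (intro quadratic_form_cong) (auto simp: y_def)
      then have "quadratic_form T a y = a u u"
        by (simp add: quadratic_form_unit[OF finT uT])
      then have "quadratic_form S a y = -1"
        using q uv \<open>a v v = 0\<close> unfolding form by (simp add: y_def)
      then show False using psd[of y] by simp
    qed
    define c where "c = (a v u)\<^sup>2 / a v v"
    define d where "d = a u u - c"
    define b where "b = a(u := (a u)(u := d))"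
    have schur: "0 \<le> quadratic_form T b y" for y
    proof -
      \<comment> \<open>The value at \<open>v\<close> that minimizes the form when the other coordinates are those of \<open>y\<close>.\<close>
      define z where "z = y(v := - a v u * y u / a v v)"
      have "quadratic_form T a z = quadratic_form T a y"
        using vT by (intro quadratic_form_cong) (auto simp: z_def)
      then have "quadratic_form S a z = quadratic_form T a y - c * (y u)\<^sup>2"
        using pos uv unfolding form c_def
        by (simp add: z_def field_simps power2_eq_square)
      also have "\<dots> = quadratic_form T b y"
        unfolding b_def quadratic_form_change_diagonal[OF finT uT] by (simp add: d_def)
      finally show ?thesis using psd[of z] by simp
    qed
    have d: "0 \<le> d"
      using schur[of "\<lambda>i. if i = u then 1 else 0"]
      by (simp add: quadratic_form_unit[OF finT uT] b_def)
    have bsym: "b i j = b j i" and bnonneg: "0 \<le> b i j" for i j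
      using sym nonneg d by (auto simp: b_def)
    have off_diagonal: "b i j = a i j" if "j \<noteq> i" for i j
      using that by (auto simp: b_def)
    have bleaf: "\<exists>i\<in>T'. \<exists>k. \<forall>j\<in>T'. j \<noteq> i \<longrightarrow> j \<noteq> k \<longrightarrow> b i j = 0"
      if "T' \<subseteq> T" "T' \<noteq> {}" for T'
    proof -
      have "T' \<subseteq> S" using that(1) S by blast
      from leaf[OF this that(2)] obtain i k
        where "i \<in> T'" "\<forall>j\<in>T'. j \<noteq> i \<longrightarrow> j \<noteq> k \<longrightarrow> a i j = 0" by blast
      then show ?thesis using off_diagonal by (intro bexI[of _ i] exI[of _ k]) auto
    qed
    have "0 \<le> quadratic_form T (\<lambda>i j. b i j powr \<alpha>) x"
      by (rule Suc.hyps(1)[OF cardT finT bsym bnonneg bleaf schur])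
    also have "quadratic_form T (\<lambda>i j. b i j powr \<alpha>) x =
        quadratic_form T (?p(u := (?p u)(u := d powr \<alpha>))) x"
      by (rule arg_cong[of _ _ "\<lambda>f. quadratic_form T f x"]) (auto simp: b_def fun_eq_iff)
    also have "\<dots> = quadratic_form T ?p x + (d powr \<alpha> - a u u powr \<alpha>) * (x u)\<^sup>2"
      by (rule quadratic_form_change_diagonal[OF finT uT])
    finally have IH: "0 \<le> quadratic_form T ?p x - (a u u powr \<alpha> - d powr \<alpha>) * (x u)\<^sup>2"
      by (simp add: algebra_simps)
    have c: "0 \<le> c" using pos by (simp add: c_def)
    have "c powr \<alpha> \<le> a u u powr \<alpha> - d powr \<alpha>"
      using powr_superadditive[OF c d \<open>1 \<le> \<alpha>\<close>] by (simp add: d_def)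
    then have "c powr \<alpha> * (x u)\<^sup>2 \<le> (a u u powr \<alpha> - d powr \<alpha>) * (x u)\<^sup>2"
      by (intro mult_right_mono) auto
    \<comment> \<open>What is left over in the coordinates \<open>v\<close> and \<open>u\<close> is singular, as \<open>(a v u)\<^sup>2 = a v v * c\<close>.\<close>
    moreover have "(a v u powr \<alpha>)\<^sup>2 = a v v powr \<alpha> * c powr \<alpha>"
      using pos q c unfolding power2_eq_square
      by (simp add: powr_mult[symmetric] c_def power2_eq_square)
    then have "0 \<le> ?p v v * (x v)\<^sup>2 + 2 * ?p v u * x u * x v + c powr \<alpha> * (x u)\<^sup>2"
      using pos by (intro binary_form_nonneg) auto
    moreover have "quadratic_form S ?p x =
        ?p v v * (x v)\<^sup>2 + 2 * ?p v u * x u * x v + quadratic_form T ?p x"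
      unfolding S using nbr sym[of u v]
      by (intro quadratic_form_insert_leaf finT vT uT) auto
    ultimately show ?thesis using IH by linarith
  qed
qed

section \<open>Powers below one\<close>

text \<open>
  The vertices \<open>u\<close> and \<open>w\<close> may be adjacent or not: the entry between them is \<open>0\<close>, which both cases
  allow.
\<close>

lemma two_edge_matrix:
  fixes G :: "'n::finite pair_pre_digraph"
  assumes G: "pair_graph G" and edges: "(v, u) \<in> parcs G" "(v, w) \<in> parcs G" "u \<noteq> w"
    and "0 < \<epsilon>" "\<alpha> < 1"
  defines "A \<equiv> (\<chi> i j. \<epsilon> * (indicator {v, u} i * indicator {v, u} j
                            + indicator {v, w} i * indicator {v, w} j)) :: real^'n^'n"
  shows "A \<in> \<P>\<^bsub>G\<^esub> {0..2 * \<epsilon>}" and "A \<circ>powr \<alpha> \<notin> \<P>\<^bsub>G\<^esub> I"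
proof -
  interpret pair_graph G by fact
  have neq: "v \<noteq> u" "v \<noteq> w" using edges no_loops' by auto
  define s t where "s = (indicator {v, u} :: 'n \<Rightarrow> real)" and "t = (indicator {v, w} :: 'n \<Rightarrow> real)"
  have A: "A $ i $ j = \<epsilon> * (s i * s j + t i * t j)" for i j
    by (simp add: A_def s_def t_def)
  have rank_two: "quadratic_form UNIV (\<lambda>i j. e * (s i * s j + t i * t j)) x =
      e * ((\<Sum>i\<in>UNIV. s i * x i)\<^sup>2 + (\<Sum>i\<in>UNIV. t i * x i)\<^sup>2)" for e x
    by (simp add: quadratic_form_def power2_eq_square sum_product sum_distrib_left
        sum.distrib[symmetric] algebra_simps)
  have "positive_semidefinite A"
    using \<open>0 < \<epsilon>\<close> by (simp add: positive_semidefinite_iff_quadratic_form A rank_two)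
  moreover have "transpose A = A"
    by (simp add: vec_eq_iff transpose_def A mult.commute)
  moreover have "A $ i $ j \<in> {0..2 * \<epsilon>}" for i j
    using \<open>0 < \<epsilon>\<close> by (auto simp: A s_def t_def indicator_def)
  moreover have "A $ i $ j = 0" if "i \<noteq> j" "(i, j) \<notin> parcs G" for i j
    using that edges arcs_symmetric by (auto simp: A s_def t_def indicator_def)
  ultimately show "A \<in> \<P>\<^bsub>G\<^esub> {0..2 * \<epsilon>}" by (auto simp: psd_matrices_on_def)

  define p where "p = (\<lambda>i j. \<epsilon> powr \<alpha> * (s i * s j + t i * t j))"
  define x where "x = (\<lambda>i. if i = v then 1 else if i \<in> {u, w} then -1 else 0 :: real)"
  have "(\<Sum>i\<in>UNIV. s i * x i) = (\<Sum>i\<in>{v, u}. x i)" "(\<Sum>i\<in>UNIV. t i * x i) = (\<Sum>i\<in>{v, w}. x i)"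
    unfolding s_def t_def by (auto simp: sum_indicator_mult intro: sum.cong)
  \<comment> \<open>Both sums vanish, so the vector \<open>x\<close> is in the kernel of the \<open>0\<close>-\<open>1\<close>-\<open>2\<close> matrix.\<close>
  then have null: "quadratic_form UNIV p x = 0"
    using neq unfolding p_def rank_two by (simp add: x_def)
  have power: "(\<lambda>i j. (A \<circ>powr \<alpha>) $ i $ j) = p(v := (p v)(v := (2 * \<epsilon>) powr \<alpha>))"
    using neq \<open>u \<noteq> w\<close>
    by (auto simp: fun_eq_iff hadamard_power_def map_matrix_def A p_def s_def t_def indicator_def mult.commute)
  have "quadratic_form UNIV (\<lambda>i j. (A \<circ>powr \<alpha>) $ i $ j) x = (2 * \<epsilon>) powr \<alpha> - p v v"
    unfolding power using quadratic_form_change_diagonal[of UNIV v p "(2 * \<epsilon>) powr \<alpha>" x] null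
    by (simp add: x_def)
  also have "\<dots> = (2 powr \<alpha> - 2) * \<epsilon> powr \<alpha>"
    using \<open>0 < \<epsilon>\<close> by (simp add: p_def s_def t_def powr_mult algebra_simps)
  also have "\<dots> < 0"
    using \<open>0 < \<epsilon>\<close> powr_less_mono[of \<alpha> 1 2] \<open>\<alpha> < 1\<close> by (simp add: mult_less_0_iff)
  finally have negative: "quadratic_form UNIV (\<lambda>i j. (A \<circ>powr \<alpha>) $ i $ j) x < 0" .
  have "\<not> positive_semidefinite (A \<circ>powr \<alpha>)"
  proof
    assume "positive_semidefinite (A \<circ>powr \<alpha>)"
    then have "0 \<le> quadratic_form UNIV (\<lambda>i j. (A \<circ>powr \<alpha>) $ i $ j) x"
      by (simp only: positive_semidefinite_iff_quadratic_form)
    with negative show False by simp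
  qed
  then show "A \<circ>powr \<alpha> \<notin> \<P>\<^bsub>G\<^esub> I" by (simp add: psd_matrices_on_def)
qed

section \<open>Entrywise powers preserving positivity on a tree\<close>

theorem proposition4p2:
  fixes G :: "'n::finite pair_pre_digraph"
  assumes "undirected_tree G" and "pverts G = UNIV" and "CARD('n) \<ge> 3"
  shows "(\<forall>A \<in> \<P>\<^bsub>G\<^esub> {0..}. \<forall>\<alpha>::real. \<alpha> \<ge> 1 \<longrightarrow> A \<circ>powr \<alpha> \<in> \<P>\<^bsub>G\<^esub> UNIV) \<and>
    (\<forall>(\<alpha>::real) (R::ereal). 0 < \<alpha> \<and> \<alpha> < 1 \<and> 0 < R \<and> R \<le> \<infinity> \<longrightarrow>
       (\<exists>A\<^sub>R \<in> \<P>\<^bsub>G\<^esub> {x. 0 \<le> x \<and> ereal x < R}. A\<^sub>R \<circ>powr \<alpha> \<notin> \<P>\<^bsub>G\<^esub> UNIV))"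
proof (intro conjI ballI allI impI)
  fix A \<alpha> assume A: "A \<in> \<P>\<^bsub>G\<^esub> {0..}" and \<alpha>: "(\<alpha>::real) \<ge> 1"
  let ?a = "\<lambda>i j. A $ i $ j"
  have sym: "?a i j = ?a j i" for i j
  proof -
    have "transpose A $ i $ j = A $ i $ j" using A by (simp add: psd_matrices_on_def)
    then show ?thesis by (simp add: transpose_def)
  qed
  have zero: "?a i j = 0" if "i \<noteq> j" "(i, j) \<notin> parcs G" for i j
    using A that by (simp add: psd_matrices_on_def)
  have nonneg: "0 \<le> ?a i j" for i j
    using A by (simp add: psd_matrices_on_def)
  have psd: "0 \<le> quadratic_form UNIV ?a x" for x
    using A by (simp add: psd_matrices_on_def positive_semidefinite_iff_quadratic_form)
  have leaf: "\<exists>v\<in>T. \<exists>u. \<forall>w\<in>T. w \<noteq> v \<longrightarrow> w \<noteq> u \<longrightarrow> ?a v w = 0" if "T \<noteq> {}" for T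
    using undirected_tree_leaf[OF assms(1), of T] that assms(2) zero by (metis subset_UNIV)
  have entry: "(A \<circ>powr \<alpha>) $ i $ j = ?a i j powr \<alpha>" for i j
    by (simp add: hadamard_power_def map_matrix_def)
  have "positive_semidefinite (A \<circ>powr \<alpha>)"
    unfolding positive_semidefinite_iff_quadratic_form entry
    using forest_powr_nonneg[OF finite sym nonneg leaf psd \<alpha>] by blast
  moreover have "transpose (A \<circ>powr \<alpha>) = A \<circ>powr \<alpha>"
    using sym by (simp add: vec_eq_iff transpose_def entry)
  ultimately show "A \<circ>powr \<alpha> \<in> \<P>\<^bsub>G\<^esub> UNIV"
    using zero by (simp add: psd_matrices_on_def entry)
next
  fix \<alpha> :: real and R :: ereal
  assume asm: "0 < \<alpha> \<and> \<alpha> < 1 \<and> 0 < R \<and> R \<le> \<infinity>"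
  have G: "pair_graph G" and conn: "Digraph_Component.connected (with_proj G)"
    using assms(1) by (auto simp: undirected_tree_def)
  obtain v u w where edges: "(v, u) \<in> parcs G" "(v, w) \<in> parcs G" "u \<noteq> w"
    using connected_vertex_with_two_neighbours[OF G conn assms(2,3)] by blast
  obtain r where r: "0 < r" "ereal r < R"
    using asm ereal_dense2[of 0 R] by (auto simp: zero_ereal_def)
  have "\<alpha> < 1" using asm by simp
  obtain A where A: "A \<in> \<P>\<^bsub>G\<^esub> {0..2 * (r / 2)}" "A \<circ>powr \<alpha> \<notin> \<P>\<^bsub>G\<^esub> UNIV"
    by (rule that[OF two_edge_matrix[OF G edges half_gt_zero[OF r(1)] \<open>\<alpha> < 1\<close>]])
  have "\<P>\<^bsub>G\<^esub> {0..2 * (r / 2)} \<subseteq> \<P>\<^bsub>G\<^esub> {x. 0 \<le> x \<and> ereal x < R}"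
    using r(2) unfolding psd_matrices_on_def by (auto intro: le_less_trans[of _ "ereal r"])
  then show "\<exists>A\<^sub>R \<in> \<P>\<^bsub>G\<^esub> {x. 0 \<le> x \<and> ereal x < R}. A\<^sub>R \<circ>powr \<alpha> \<notin> \<P>\<^bsub>G\<^esub> UNIV"
    using A by blast
qed

end
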